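(* Suppose that for any $n \in \mathbb{Z}_+$: $(\mathcal{S}_n,\rho_n)$ is a metric space and $\mathcal{N}_n$ is a finite subset of $\mathcal{S}_n$; $\{X_n(u)\}_{u\in\mathcal{S}_n}$ is a collection of random variables; $Y_n$, $M_n$ and $Z_n$ are random variables; $r_n$, $s_n$ and $\varepsilon_n$ are positive and deterministic. If 1. $\{X_n(u)\}_{u\in\mathcal{N}_n} = O_{\mathbb{P}}(Y_n;~r_n)$; 2. $\mathcal{N}_n$ is an $\varepsilon_n$-net of $\mathcal{S}_n$ and $\log|\mathcal{N}_n| \lesssim r_n$; 3. $M_n = O_{\mathbb{P}}(Z_n;~s_n)$; and for any $n\ge 1$ and $(u,v)\in\mathcal{S}_n\times\mathcal{S}_n$, $$|X_n(u)-X_n(v)| \le \Big(\frac{1}{2\varepsilon_n}\sup_{w\in\mathcal{S}_n}|X_n(w)| + M_n\Big)\rho_n(u,v), \qquad \text{a.s.};$$ then $$\sup_{u\in\mathcal{S}_n}|X_n(u)| = O_{\mathbb{P}}\big(|Y_n|+\varepsilon_n|Z_n|;~r_n\wedge s_n\big).$$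
   Context: $a\wedge b=\min\{a,b\}$. For nonnegative sequences $\{a_n\}_{n=1}^\infty$ and $\{b_n\}_{n=1}^\infty$, $a_n\lesssim b_n$ means that $a_n\le c\,b_n$ for all $n$, for some constant $c>0$. Definition of $O_{\mathbb{P}}(\cdot;\cdot)$: for two sequences of random variables $\{X_n\}_{n=1}^\infty$, $\{Y_n\}_{n=1}^\infty$ and a deterministic sequence $\{r_n\}_{n=1}^\infty\subseteq(0,+\infty)$, write $X_n=O_{\mathbb{P}}(Y_n;~r_n)$ if there exist universal constants $(C_1,C_2,N)\in(0,+\infty)^3$ and a non-decreasing function $f:[C_2,+\infty)\to(0,+\infty)$ satisfying $\lim_{x\to+\infty}f(x)=+\infty$, such that $\mathbb{P}(|X_n|\ge t|Y_n|)\le C_1e^{-r_nf(t)}$ for all $n\ge N$ and $t\ge C_2$. Uniform version: for a sequence of finite index sets $\{\Lambda_n\}_{n=1}^\infty$, collections of random variables $\{X_{n\lambda}\}_{\lambda\in\Lambda_n}$, random variables $Y_n$ and deterministic $r_n\in(0,+\infty)$, write $\{X_{n\lambda}\}_{\lambda\in\Lambda_n}=O_{\mathbb{P}}(Y_n;~r_n)$ if there exist universal constants $(C_1,C_2,N)\in(0,+\infty)^3$ and a non-decreasing function $f:[C_2,+\infty)\to(0,+\infty)$ satisfying $\lim_{x\to+\infty}f(x)=+\infty$, such that $\mathbb{P}(|X_{n\lambda}|\ge t|Y_n|)\le C_1e^{-r_nf(t)}$ for all $n\ge N$, $\lambda\in\Lambda_n$ and $t\ge C_2$. For a metric space $(\mathcal{S},\rho)$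 and $\varepsilon>0$, a subset $\mathcal{N}\subseteq\mathcal{S}$ is an $\varepsilon$-net of $\mathcal{S}$ if for any $x\in\mathcal{S}$ there exists $y\in\mathcal{N}$ such that $\rho(x,y)\le\varepsilon$.
   Formalization: The supremum of |X_n(u)| over S_n is assumed to be an almost surely finite random variable (S_n nonempty), and the "a.s." in 3 means that, for each n, one null set serves all pairs (u,v); without finiteness, or with null sets depending on (u,v), the claim is false. *)

theory Defs
  imports "HOL-Probability.Probability"
begin

text \<open>Sequences are indexed by the positive integers; the value at index 0 is irrelevant in all
  definitions below.\<close>

definition lesssim :: "(nat \<Rightarrow> real) \<Rightarrow> (nat \<Rightarrow> real) \<Rightarrow> bool"
  where "lesssim a b \<longleftrightarrow> (\<exists>c>0. \<forall>n\<ge>1. a n \<le> c * b n)"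

text \<open>The rate function \<open>f\<close> below is a function on \<open>[C2, \<infinity>)\<close>; it is represented by a function on the
  reals all of whose requirements concern its values on \<open>{C2..}\<close> only.\<close>

definition bigO_prob ::
  "'w measure \<Rightarrow> (nat \<Rightarrow> 'w \<Rightarrow> real) \<Rightarrow> (nat \<Rightarrow> 'w \<Rightarrow> real) \<Rightarrow> (nat \<Rightarrow> real) \<Rightarrow> bool"
  where "bigO_prob P X Y r \<longleftrightarrow>
    (\<exists>C1>0. \<exists>C2>0. \<exists>N>0. \<exists>f::real \<Rightarrow> real.
       mono_on {C2..} f \<and> (\<forall>x\<ge>C2. 0 < f x) \<and> filterlim f at_top at_top \<and>
       (\<forall>n\<ge>1. real n \<ge> N \<longrightarrow>
          (\<forall>t\<ge>C2. \<P>(\<omega> in P. \<bar>X n \<omega>\<bar> \<ge> t * \<bar>Y n \<omega>\<bar>) \<le> C1 * exp (- r n * f t))))"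

definition bigO_prob_unif ::
  "'w measure \<Rightarrow> (nat \<Rightarrow> 'i set) \<Rightarrow> (nat \<Rightarrow> 'i \<Rightarrow> 'w \<Rightarrow> real) \<Rightarrow> (nat \<Rightarrow> 'w \<Rightarrow> real) \<Rightarrow>
    (nat \<Rightarrow> real) \<Rightarrow> bool"
  where "bigO_prob_unif P \<Lambda> X Y r \<longleftrightarrow>
    (\<exists>C1>0. \<exists>C2>0. \<exists>N>0. \<exists>f::real \<Rightarrow> real.
       mono_on {C2..} f \<and> (\<forall>x\<ge>C2. 0 < f x) \<and> filterlim f at_top at_top \<and>
       (\<forall>n\<ge>1. real n \<ge> N \<longrightarrow>
          (\<forall>i\<in>\<Lambda> n. \<forall>t\<ge>C2.
             \<P>(\<omega> in P. \<bar>X n i \<omega>\<bar> \<ge> t * \<bar>Y n \<omega>\<bar>) \<le> C1 * exp (- r n * f t))))"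

definition eps_net :: "real \<Rightarrow> 's set \<Rightarrow> ('s \<Rightarrow> 's \<Rightarrow> real) \<Rightarrow> 's set \<Rightarrow> bool"
  where "eps_net \<epsilon> S \<rho> N \<longleftrightarrow> N \<subseteq> S \<and> (\<forall>x\<in>S. \<exists>y\<in>N. \<rho> x y \<le> \<epsilon>)"

end

theory Submission imports Defs begin

text \<open>Write \<open>G = sup |X\<^sub>n|\<close>. Comparing each \<open>u\<close> with a net point at distance at most \<open>\<epsilon>\<^sub>n\<close>, the
  assumed Lipschitz bound gives \<open>G \<le> max\<^bsub>N\<^esub> |X\<^sub>n| + G/2 + \<epsilon>\<^sub>n |M\<^sub>n|\<close>; since \<open>G\<close> is finite it can be absorbed
  on the left. A union bound over the net costs the factor \<open>|N\<^sub>n| \<le> exp (c r\<^sub>n)\<close>, which is paid for by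
  replacing the rate function \<open>f\<close> by \<open>f - c\<close>.\<close>

lemma SUP_abs_le_net:
  fixes x :: "'s \<Rightarrow> real"
  assumes net: "eps_net \<epsilon> S \<rho> N" and "finite N" and "S \<noteq> {}" and "\<epsilon> > 0"
    and nonneg: "\<And>u v. 0 \<le> \<rho> u v"
    and bdd: "bdd_above ((\<lambda>u. \<bar>x u\<bar>) ` S)"
    and lip: "\<And>u v. u \<in> S \<Longrightarrow> v \<in> S \<Longrightarrow>
      \<bar>x u - x v\<bar> \<le> (1 / (2 * \<epsilon>) * (SUP w\<in>S. \<bar>x w\<bar>) + m) * \<rho> u v"
  shows "\<exists>v\<in>N. (SUP u\<in>S. \<bar>x u\<bar>) \<le> 2 * (\<bar>x v\<bar> + \<epsilon> * \<bar>m\<bar>)"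
proof -
  define G where "G = (SUP u\<in>S. \<bar>x u\<bar>)"
  have "N \<noteq> {}"
    using net \<open>S \<noteq> {}\<close> by (auto simp: eps_net_def)
  then have "Max ((\<lambda>v. \<bar>x v\<bar>) ` N) \<in> (\<lambda>v. \<bar>x v\<bar>) ` N"
    using \<open>finite N\<close> by (intro Max_in) auto
  \<comment> \<open>Finiteness of the net lets a single maximiser \<open>v0\<close> serve for every
    \<open>u\<close>; the witness in the conclusion must not depend on \<open>u\<close>.\<close>
  then obtain v0 where v0: "v0 \<in> N" "\<bar>x v0\<bar> = Max ((\<lambda>v. \<bar>x v\<bar>) ` N)"
    by auto
  then have v0_max: "\<bar>x v\<bar> \<le> \<bar>x v0\<bar>" if "v \<in> N" for v
    using that \<open>finite N\<close> by auto
  have "0 \<le> G"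
    unfolding G_def using \<open>S \<noteq> {}\<close> bdd by (metis abs_ge_zero cSUP_upper2 ex_in_conv)
  have "G \<le> \<bar>x v0\<bar> + (G / 2 + \<epsilon> * \<bar>m\<bar>)"
    unfolding G_def
  proof (rule cSUP_least[OF \<open>S \<noteq> {}\<close>], fold G_def)
    fix u assume "u \<in> S"
    then obtain v where v: "v \<in> N" "v \<in> S" "\<rho> u v \<le> \<epsilon>"
      using net unfolding eps_net_def by blast
    have "\<bar>x u - x v\<bar> \<le> (1 / (2 * \<epsilon>) * G + m) * \<rho> u v"
      unfolding G_def by (rule lip) fact+
    \<comment> \<open>\<open>m\<close> may be negative. Passing to its absolute value makes the
      first factor nonnegative (here \<open>0 \<le> G\<close> enters), so that the distance can be
      raised to \<open>\<epsilon>\<close>.\<close>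
    also have "\<dots> \<le> (1 / (2 * \<epsilon>) * G + \<bar>m\<bar>) * \<epsilon>"
      using \<open>0 \<le> G\<close> \<open>\<epsilon> > 0\<close> v(3) nonneg by (intro mult_mono) auto
    also have "\<dots> = G / 2 + \<epsilon> * \<bar>m\<bar>"
      using \<open>\<epsilon> > 0\<close> by (simp add: field_simps)
    finally show "\<bar>x u\<bar> \<le> \<bar>x v0\<bar> + (G / 2 + \<epsilon> * \<bar>m\<bar>)"
      using v0_max[OF v(1)] by linarith
  qed
  then show ?thesis
    unfolding G_def using v0(1) by (intro bexI[of _ v0]) auto
qed

text \<open>Builds the rate function of the conclusion. The argument \<open>t / 2\<close> reflects
  the factor 2 in the bound on the supremum, and the shift by \<open>c\<close> pays for the union
  bound. The shift can make small values negative, so the domain has to start further right, which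
  divergence to infinity permits.\<close>

lemma obtain_min_of_rates:
  fixes f g :: "real \<Rightarrow> real"
  assumes f: "filterlim f at_top at_top" "mono_on {A..} f"
    and g: "filterlim g at_top at_top" "mono_on {B..} g"
  obtains C where "C > 0" "2 * A \<le> C" "2 * B \<le> C"
    "mono_on {C..} (\<lambda>t. min (f (t / 2) - c) (g (t / 2)))"
    "\<And>t. t \<ge> C \<Longrightarrow> 0 < min (f (t / 2) - c) (g (t / 2))"
    "filterlim (\<lambda>t. min (f (t / 2) - c) (g (t / 2))) at_top at_top"
proof -
  define h where "h t = min (f (t / 2) - c) (g (t / 2))" for t
  have half: "filterlim (\<lambda>t::real. t / 2) at_top at_top"
    unfolding filterlim_at_top
  proof
    show "\<forall>\<^sub>F t in at_top. K \<le> t / 2" for K :: real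
      using eventually_ge_at_top[of "2 * K"] by eventually_elim simp
  qed
  have lim: "filterlim h at_top at_top"
    unfolding filterlim_at_top
  proof
    fix K
    have "\<forall>\<^sub>F t in at_top. K + c \<le> f (t / 2)" "\<forall>\<^sub>F t in at_top. K \<le> g (t / 2)"
      using filterlim_compose[OF f(1) half] filterlim_compose[OF g(1) half]
      unfolding filterlim_at_top by blast+
    then show "\<forall>\<^sub>F t in at_top. K \<le> h t"
      by eventually_elim (auto simp: h_def)
  qed
  then have "\<forall>\<^sub>F t in at_top. 0 < h t"
    by (simp add: filterlim_at_top_dense)
  then obtain D where D: "\<And>t. t \<ge> D \<Longrightarrow> 0 < h t"
    by (auto simp: eventually_at_top_linorder)
  \<comment> \<open>The entry 1 makes \<open>C\<close> positive, \<open>2 * A\<close> and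
    \<open>2 * B\<close> keep \<open>t / 2\<close> where \<open>f\<close> and \<open>g\<close> are
    monotone, and \<open>D\<close> secures positivity of \<open>h\<close>.\<close>
  define C where "C = Max {1, 2 * A, 2 * B, D}"
  have C: "1 \<le> C" "2 * A \<le> C" "2 * B \<le> C" "D \<le> C"
    unfolding C_def by auto
  have "mono_on {C..} h"
  proof (rule mono_onI)
    fix t u assume "t \<in> {C..}" "u \<in> {C..}" "t \<le> u"
    then have "f (t / 2) \<le> f (u / 2)" "g (t / 2) \<le> g (u / 2)"
      using C by (auto intro!: mono_onD[OF f(2)] mono_onD[OF g(2)])
    then show "h t \<le> h u"
      by (auto simp: h_def)
  qed
  with that[of C] C D lim show ?thesis
    by (auto simp: h_def[abs_def])
qed

text \<open>Since \<open>k \<le> exp (c * r)\<close>, the factor \<open>k\<close> turns the exponent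
  \<open>- r * F\<close> into \<open>- r * (F - c)\<close>. Rate and exponent can then be lowered to
  the two minima, because all quantities involved are positive.\<close>

lemma exp_union_bound:
  fixes r s :: real
  assumes card: "1 \<le> k" "ln k \<le> c * r" and "0 < a" "0 < b" "0 < r" "0 < s"
    and pos: "0 < min (F - c) H"
  shows "k * (a * exp (- r * F)) + b * exp (- s * H)
    \<le> (a + b) * exp (- min r s * min (F - c) H)"
proof -
  have "k \<le> exp (c * r)"
    using card by (metis exp_le_cancel_iff exp_ln less_le_trans zero_less_one)
  then have "k * (a * exp (- r * F)) \<le> exp (c * r) * (a * exp (- r * F))"
    using \<open>0 < a\<close> by (intro mult_right_mono) auto
  also have "\<dots> = a * exp (- (r * (F - c)))"
    by (simp add: exp_add[symmetric] algebra_simps)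
  also have "\<dots> \<le> a * exp (- (min r s * min (F - c) H))"
    using assms by (intro mult_left_mono iffD2[OF exp_le_cancel_iff] le_imp_neg_le mult_mono) auto
  finally have 1: "k * (a * exp (- r * F)) \<le> a * exp (- (min r s * min (F - c) H))" .
  have "b * exp (- (s * H)) \<le> b * exp (- (min r s * min (F - c) H))"
    using assms by (intro mult_left_mono iffD2[OF exp_le_cancel_iff] le_imp_neg_le mult_mono) auto
  with 1 show ?thesis
    by (simp add: distrib_right)
qed

theorem theorem1:
  fixes P :: "'w measure"
    and S :: "nat \<Rightarrow> 's set" and \<rho> :: "nat \<Rightarrow> 's \<Rightarrow> 's \<Rightarrow> real"
    and N :: "nat \<Rightarrow> 's set"
    and X :: "nat \<Rightarrow> 's \<Rightarrow> 'w \<Rightarrow> real"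
    and Y M Z :: "nat \<Rightarrow> 'w \<Rightarrow> real"
    and r s \<epsilon> :: "nat \<Rightarrow> real"
  assumes prob: "prob_space P"
    and metric: "\<And>n. n \<ge> 1 \<Longrightarrow> Metric_space (S n) (\<rho> n)"
    and nonempty: "\<And>n. n \<ge> 1 \<Longrightarrow> S n \<noteq> {}"
    and N_finite: "\<And>n. n \<ge> 1 \<Longrightarrow> finite (N n)"
    and N_subset: "\<And>n. n \<ge> 1 \<Longrightarrow> N n \<subseteq> S n"
    and X_rv: "\<And>n u. n \<ge> 1 \<Longrightarrow> u \<in> S n \<Longrightarrow> X n u \<in> borel_measurable P"
    and Y_rv: "\<And>n. n \<ge> 1 \<Longrightarrow> Y n \<in> borel_measurable P"
    and M_rv: "\<And>n. n \<ge> 1 \<Longrightarrow> M n \<in> borel_measurable P"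
    and Z_rv: "\<And>n. n \<ge> 1 \<Longrightarrow> Z n \<in> borel_measurable P"
    and sup_finite: "\<And>n. n \<ge> 1 \<Longrightarrow> AE \<omega> in P. bdd_above ((\<lambda>u. \<bar>X n u \<omega>\<bar>) ` S n)"
    and sup_rv: "\<And>n. n \<ge> 1 \<Longrightarrow> (\<lambda>\<omega>. SUP u\<in>S n. \<bar>X n u \<omega>\<bar>) \<in> borel_measurable P"
    and r_pos: "\<And>n. n \<ge> 1 \<Longrightarrow> r n > 0"
    and s_pos: "\<And>n. n \<ge> 1 \<Longrightarrow> s n > 0"
    and eps_pos: "\<And>n. n \<ge> 1 \<Longrightarrow> \<epsilon> n > 0"
    and X_bound: "bigO_prob_unif P N X Y r"
    and net: "\<And>n. n \<ge> 1 \<Longrightarrow> eps_net (\<epsilon> n) (S n) (\<rho> n) (N n)"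
    and log_card: "lesssim (\<lambda>n. ln (real (card (N n)))) r"
    and M_bound: "bigO_prob P M Z s"
    and lipschitz: "\<And>n. n \<ge> 1 \<Longrightarrow> AE \<omega> in P. \<forall>u\<in>S n. \<forall>v\<in>S n.
        \<bar>X n u \<omega> - X n v \<omega>\<bar>
          \<le> (1 / (2 * \<epsilon> n) * (SUP w\<in>S n. \<bar>X n w \<omega>\<bar>) + M n \<omega>) * \<rho> n u v"
  shows "bigO_prob P (\<lambda>n \<omega>. SUP u\<in>S n. \<bar>X n u \<omega>\<bar>)
           (\<lambda>n \<omega>. \<bar>Y n \<omega>\<bar> + \<epsilon> n * \<bar>Z n \<omega>\<bar>) (\<lambda>n. min (r n) (s n))"
proof -
  interpret prob_space P by (rule prob)
  define G where "G n \<omega> = (SUP u\<in>S n. \<bar>X n u \<omega>\<bar>)" for n \<omega>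
  obtain a A N1 f where f: "a > 0" "A > 0" "mono_on {A..} f" "filterlim f at_top at_top"
    "N1 > 0" and X_tail: "\<And>n u t. n \<ge> 1 \<Longrightarrow> real n \<ge> N1 \<Longrightarrow> u \<in> N n \<Longrightarrow> t \<ge> A \<Longrightarrow>
      \<P>(\<omega> in P. \<bar>X n u \<omega>\<bar> \<ge> t * \<bar>Y n \<omega>\<bar>) \<le> a * exp (- r n * f t)"
    using X_bound unfolding bigO_prob_unif_def by (elim exE conjE) (rule that; blast)
  obtain b B N2 g where g: "b > 0" "B > 0" "mono_on {B..} g" "filterlim g at_top at_top"
    "N2 > 0" and M_tail: "\<And>n t. n \<ge> 1 \<Longrightarrow> real n \<ge> N2 \<Longrightarrow> t \<ge> B \<Longrightarrow>
      \<P>(\<omega> in P. \<bar>M n \<omega>\<bar> \<ge> t * \<bar>Z n \<omega>\<bar>) \<le> b * exp (- s n * g t)"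
    using M_bound unfolding bigO_prob_def by (elim exE conjE) (rule that; blast)
  obtain c where c: "\<And>n. n \<ge> 1 \<Longrightarrow> ln (real (card (N n))) \<le> c * r n"
    using log_card unfolding lesssim_def by auto
  define h where "h t = min (f (t / 2) - c) (g (t / 2))" for t
  obtain C where C: "C > 0" "2 * A \<le> C" "2 * B \<le> C" "mono_on {C..} h"
    "\<And>t. t \<ge> C \<Longrightarrow> 0 < h t" "filterlim h at_top at_top"
    by (rule obtain_min_of_rates[OF f(4,3) g(4,3), where c = c, folded h_def]) (rule that)
  have tail: "\<P>(\<omega> in P. \<bar>G n \<omega>\<bar> \<ge> t * \<bar>\<bar>Y n \<omega>\<bar> + \<epsilon> n * \<bar>Z n \<omega>\<bar>\<bar>)
      \<le> (a + b) * exp (- min (r n) (s n) * h t)"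
    if n: "n \<ge> 1" "real n \<ge> max N1 N2" and t: "t \<ge> C" for n t
  proof -
    note [measurable] = X_rv[OF n(1)] Y_rv[OF n(1)] M_rv[OF n(1)] Z_rv[OF n(1)]
    \<comment> \<open>The bad events carry the threshold \<open>t / 2\<close> because the supremum
      is bounded by twice a sum of an \<open>X\<close> term and an \<open>M\<close> term.\<close>
    define E where "E u = {\<omega> \<in> space P. t / 2 * \<bar>Y n \<omega>\<bar> \<le> \<bar>X n u \<omega>\<bar>}" for u
    define F where "F = {\<omega> \<in> space P. t / 2 * \<bar>Z n \<omega>\<bar> \<le> \<bar>M n \<omega>\<bar>}"
    have E_sets: "E u \<in> sets P" if "u \<in> N n" for u
    proof -
      have [measurable]: "X n u \<in> borel_measurable P"
        using that N_subset X_rv n(1) by blast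
      show ?thesis unfolding E_def by measurable
    qed
    have F_sets: "F \<in> sets P"
      unfolding F_def by measurable
    \<comment> \<open>The inclusion of events holds only off a null set. In the Lipschitz hypothesis
      the quantifiers over pairs of points stand inside \<open>AE\<close>, so one null set serves
      all pairs even when \<open>S n\<close> is uncountable.\<close>
    have "AE \<omega> in P. \<omega> \<in> {\<omega> \<in> space P. t * \<bar>\<bar>Y n \<omega>\<bar> + \<epsilon> n * \<bar>Z n \<omega>\<bar>\<bar> \<le> \<bar>G n \<omega>\<bar>}
        \<longrightarrow> \<omega> \<in> (\<Union>u\<in>N n. E u) \<union> F"
      using sup_finite[OF n(1)] lipschitz[OF n(1)]
    proof eventually_elim
      case (elim \<omega>)
      \<comment> \<open>The net point depends on the outcome, which is why the union over the whole
        net appears.\<close>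
      obtain v where v: "v \<in> N n" "G n \<omega> \<le> 2 * (\<bar>X n v \<omega>\<bar> + \<epsilon> n * \<bar>M n \<omega>\<bar>)"
        using SUP_abs_le_net[OF net N_finite nonempty eps_pos
            Metric_space.nonneg[OF metric], of n "\<lambda>u. X n u \<omega>" "M n \<omega>"] n(1) elim
        unfolding G_def by blast
      obtain u where "u \<in> S n"
        using nonempty[OF n(1)] by blast
      \<comment> \<open>Allows the absolute value around \<open>G n \<omega>\<close> to be dropped
        below.\<close>
      then have G_nonneg: "0 \<le> G n \<omega>"
        unfolding G_def using elim(1) by (intro cSUP_upper2) auto
      show ?case
      proof (intro impI)
        assume \<omega>: "\<omega> \<in> {\<omega> \<in> space P. t * \<bar>\<bar>Y n \<omega>\<bar> + \<epsilon> n * \<bar>Z n \<omega>\<bar>\<bar> \<le> \<bar>G n \<omega>\<bar>}"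
        have "\<bar>\<bar>Y n \<omega>\<bar> + \<epsilon> n * \<bar>Z n \<omega>\<bar>\<bar> = \<bar>Y n \<omega>\<bar> + \<epsilon> n * \<bar>Z n \<omega>\<bar>"
          using eps_pos[OF n(1)] by simp
        with \<omega> v(2) G_nonneg
        have "t / 2 * \<bar>Y n \<omega>\<bar> + \<epsilon> n * (t / 2 * \<bar>Z n \<omega>\<bar>) \<le> \<bar>X n v \<omega>\<bar> + \<epsilon> n * \<bar>M n \<omega>\<bar>"
          by (simp add: algebra_simps)
        \<comment> \<open>If one sum of two terms is at most another, at least one of the two
          termwise inequalities holds. The first case leads to \<open>E v\<close>, the second to
          \<open>F\<close>.\<close>
        then have "t / 2 * \<bar>Y n \<omega>\<bar> \<le> \<bar>X n v \<omega>\<bar> \<or> \<epsilon> n * (t / 2 * \<bar>Z n \<omega>\<bar>) \<le> \<epsilon> n * \<bar>M n \<omega>\<bar>"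
          by linarith
        then have "t / 2 * \<bar>Y n \<omega>\<bar> \<le> \<bar>X n v \<omega>\<bar> \<or> t / 2 * \<bar>Z n \<omega>\<bar> \<le> \<bar>M n \<omega>\<bar>"
          using eps_pos[OF n(1)] by (simp only: mult_le_cancel_left_pos)
        with \<omega> v(1) show "\<omega> \<in> (\<Union>u\<in>N n. E u) \<union> F"
          by (auto simp: E_def F_def)
      qed
    qed
    then have "\<P>(\<omega> in P. \<bar>G n \<omega>\<bar> \<ge> t * \<bar>\<bar>Y n \<omega>\<bar> + \<epsilon> n * \<bar>Z n \<omega>\<bar>\<bar>) \<le> prob ((\<Union>u\<in>N n. E u) \<union> F)"
      using E_sets F_sets N_finite[OF n(1)]
      by (intro finite_measure_mono_AE sets.Un sets.finite_UN) auto
    also have "\<dots> \<le> prob (\<Union>u\<in>N n. E u) + prob F"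
      using E_sets F_sets N_finite[OF n(1)]
      by (intro measure_Un_le sets.finite_UN) auto
    also have "\<dots> \<le> (\<Sum>u\<in>N n. prob (E u)) + prob F"
      using E_sets N_finite[OF n(1)]
      by (intro add_right_mono finite_measure_subadditive_finite) auto
    \<comment> \<open>From \<open>t \<ge> C\<close> it follows that \<open>t / 2\<close> is at least
      \<open>A\<close> and at least \<open>B\<close>, so both tail hypotheses apply.\<close>
    also have "\<dots> \<le> (\<Sum>u\<in>N n. a * exp (- r n * f (t / 2))) + b * exp (- s n * g (t / 2))"
      using X_tail[OF n(1), of _ "t / 2"] M_tail[OF n(1), of "t / 2"] n t C(2,3)
      by (intro add_mono sum_mono) (auto simp: E_def F_def)
    also have "\<dots> = real (card (N n)) * (a * exp (- r n * f (t / 2))) + b * exp (- s n * g (t / 2))"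
      by simp
    also have "\<dots> \<le> (a + b) * exp (- min (r n) (s n) * h t)"
    proof -
      have "N n \<noteq> {}"
        using net[OF n(1)] nonempty[OF n(1)] by (auto simp: eps_net_def)
      \<comment> \<open>The bound on the logarithm controls the cardinality only when the latter is
        positive, as \<open>ln 0\<close> is a mere default value.\<close>
      then have "card (N n) \<ge> 1"
        using N_finite[OF n(1)] by (simp add: Suc_leI card_gt_0_iff)
      then show ?thesis
        unfolding h_def using c[OF n(1)] f(1) g(1) r_pos[OF n(1)] s_pos[OF n(1)] C(5)[OF t]
        by (intro exp_union_bound) (auto simp: h_def)
    qed
    finally show ?thesis .
  qed
  show ?thesis
    unfolding bigO_prob_def G_def[symmetric]
    using f(1,5) g(1,5) C tail
    by (intro exI[of _ "a + b"] exI[of _ C] exI[of _ "max N1 N2"] exI[of _ h] conjI) auto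
qed

end
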